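(* For all $n\geq1$ and $\sigma\in\{231,312\}$, $j_n(\{213,\sigma\})=2^{\lfloor (n-1)/2\rfloor}$.
   Context: A permutation of a finite set $S$ of positive integers is a word in which each element of $S$ appears exactly once; $\mathfrak{S}_n$ is the set of permutations of $\{1,\dots,n\}$. For a permutation $\pi$ and a letter $x$ of $\pi$, $\rho_\pi(x)$ is the maximal consecutive subword of $\pi$ consisting of the letters immediately to the right of $x$ that are all larger than $x$. $\pi$ is Jacobi if $|\rho_\pi(x)|$ is even for all letters $x$. A permutation $\pi$ avoids a pattern $\sigma$ if no subword of $\pi$ has standardization (relative order) $\sigma$. For a set $\Pi$ of patterns, $j_n(\Pi)$ is the number of Jacobi permutations in $\mathfrak{S}_n$ avoiding every pattern in $\Pi$. *)

theory Defs
  imports "HOL-Combinatorics.Multiset_Permutations" "HOL-Library.Sublist"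
begin

text \<open>
  A permutation of a finite set \<open>S\<close> of positive integers is represented by its one-line word,
  i.e. by an element of \<^term>\<open>permutations_of_set S\<close>.
\<close>

definition rho :: "nat list \<Rightarrow> nat \<Rightarrow> nat list" where
  "rho \<pi> x = takeWhile (\<lambda>y. x < y) (tl (dropWhile (\<lambda>y. y \<noteq> x) \<pi>))"

definition jacobi :: "nat list \<Rightarrow> bool" where
  "jacobi \<pi> \<longleftrightarrow> (\<forall>x \<in> set \<pi>. even (length (rho \<pi> x)))"

text \<open>
  The standardization of a word with distinct letters replaces its \<open>k\<close>-th smallest letter by \<open>k\<close>.
\<close>

definition standardize :: "nat list \<Rightarrow> nat list" where
  "standardize w = map (\<lambda>x. card {y \<in> set w. y \<le> x}) w"

text \<open>Subwords in pattern containment need not be consecutive.\<close>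

definition avoids :: "nat list \<Rightarrow> nat list \<Rightarrow> bool" where
  "avoids \<pi> \<sigma> \<longleftrightarrow> \<not> (\<exists>w. subseq w \<pi> \<and> standardize w = \<sigma>)"

definition jacobi_avoiders :: "nat \<Rightarrow> nat list set \<Rightarrow> nat list set" where
  "jacobi_avoiders n P =
     {\<pi> \<in> permutations_of_set {1..n}. jacobi \<pi> \<and> (\<forall>\<sigma> \<in> P. avoids \<pi> \<sigma>)}"

definition j_num :: "nat \<Rightarrow> nat list set \<Rightarrow> nat" where
  "j_num n P = card (jacobi_avoiders n P)"

end

theory Submission
  imports Defs
begin

text \<open>
  A word avoids 213 and 231 iff each letter is the minimum or the maximum of the suffix it starts;
  it avoids 213 and 312 iff it has no interior valley. Hence an avoider on \<open>S\<close> arises from a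
  shorter one either by prepending \<open>Max S\<close> (respectively appending \<open>Min S\<close>), which
  preserves the Jacobi property, or by prepending \<open>Min S\<close>, which preserves it
  exactly when the remaining word has even length. So the count doubles at every odd size \<open>> 1\<close>
  and is unchanged at every even size.
\<close>

section \<open>Length-three patterns as inequalities between letters\<close>

text \<open>Equal letters receive equal ranks, while each of these patterns has three different
  entries. Hence the equivalences need no distinctness hypothesis.\<close>

lemma standardize_triple:
  "standardize [a, b, c] = [2, 1, 3] \<longleftrightarrow> b < a \<and> a < c"
  "standardize [a, b, c] = [2, 3, 1] \<longleftrightarrow> c < a \<and> a < b"
  "standardize [a, b, c] = [3, 1, 2] \<longleftrightarrow> b < c \<and> c < a"
proof -
  \<comment> \<open>The conditions \<open>b \<noteq> a\<close>, \<open>c \<noteq> a\<close> and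
    \<open>c \<noteq> b\<close> make a repeated letter count only once.\<close>
  have card: "card {y \<in> set [a, b, c]. y \<le> x} =
      (if a \<le> x then 1 else 0) + (if b \<le> x \<and> b \<noteq> a then 1 else 0) +
      (if c \<le> x \<and> c \<noteq> a \<and> c \<noteq> b then 1 else 0)" for x
  proof -
    have "{y \<in> set [a, b, c]. y \<le> x} = (if a \<le> x then {a} else {}) \<union>
        (if b \<le> x \<and> b \<noteq> a then {b} else {}) \<union> (if c \<le> x \<and> c \<noteq> a \<and> c \<noteq> b then {c} else {})"
      by auto
    then show ?thesis by (simp only:) (simp add: card_insert_if)
  qed
  show "standardize [a, b, c] = [2, 1, 3] \<longleftrightarrow> b < a \<and> a < c"
    "standardize [a, b, c] = [2, 3, 1] \<longleftrightarrow> c < a \<and> a < b"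
    "standardize [a, b, c] = [3, 1, 2] \<longleftrightarrow> b < c \<and> c < a"
    unfolding standardize_def list.map card by (auto split: if_splits)
qed

text \<open>Standardization preserves length, so only subwords of length three can match.\<close>

lemma avoids_length_3:
  assumes "length \<sigma> = 3"
  shows "avoids \<pi> \<sigma> \<longleftrightarrow> (\<forall>a b c. subseq [a, b, c] \<pi> \<longrightarrow> standardize [a, b, c] \<noteq> \<sigma>)"
proof -
  have "\<exists>a b c. w = [a, b, c]" if "standardize w = \<sigma>" for w
  proof -
    have "length w = 3" using that assms by (auto simp: standardize_def)
    then show ?thesis by (auto simp: numeral_3_eq_3 length_Suc_conv)
  qed
  then show ?thesis unfolding avoids_def by metis
qed

lemma avoids_213_iff:
  "avoids \<pi> [2, 1, 3] \<longleftrightarrow> (\<forall>a b c. subseq [a, b, c] \<pi> \<longrightarrow> \<not> (b < a \<and> a < c))"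
  using avoids_length_3[of "[2, 1, 3]" \<pi>] unfolding standardize_triple by simp

lemma avoids_231_iff:
  "avoids \<pi> [2, 3, 1] \<longleftrightarrow> (\<forall>a b c. subseq [a, b, c] \<pi> \<longrightarrow> \<not> (c < a \<and> a < b))"
  using avoids_length_3[of "[2, 3, 1]" \<pi>] unfolding standardize_triple by simp

lemma avoids_312_iff:
  "avoids \<pi> [3, 1, 2] \<longleftrightarrow> (\<forall>a b c. subseq [a, b, c] \<pi> \<longrightarrow> \<not> (b < c \<and> c < a))"
  using avoids_length_3[of "[3, 1, 2]" \<pi>] unfolding standardize_triple by simp

lemma avoids_subseq: "avoids \<pi> \<sigma> \<Longrightarrow> subseq \<pi>' \<pi> \<Longrightarrow> avoids \<pi>' \<sigma>"
  unfolding avoids_def using subseq_order.order_trans by blast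

section \<open>Pattern avoidance after adding a letter at an end\<close>

lemma subseq_pair_total:
  "b \<in> set u \<Longrightarrow> c \<in> set u \<Longrightarrow> b \<noteq> c \<Longrightarrow> subseq [b, c] u \<or> subseq [c, b] u"
  by (induction u) (auto simp: subseq_singleton_left)

lemma set_subseq: "subseq xs ys \<Longrightarrow> set xs \<subseteq> set ys"
  by (auto dest: list_emb_set)

text \<open>An occurrence not contained in \<open>u\<close> starts at the leading \<open>x\<close>,
  which then has the middle value. The other two letters may come in either order, since both orders
  are forbidden; this turns the condition on \<open>x\<close> into one about values only.\<close>

lemma avoids_213_231_Cons:
  "avoids (x # u) [2, 1, 3] \<and> avoids (x # u) [2, 3, 1] \<longleftrightarrow>
   avoids u [2, 1, 3] \<and> avoids u [2, 3, 1] \<and> \<not> (\<exists>b\<in>set u. \<exists>c\<in>set u. b < x \<and> x < c)"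
  (is "?L \<longleftrightarrow> ?R")
proof
  assume L: ?L
  then have "avoids u [2, 1, 3]" "avoids u [2, 3, 1]"
    by (auto intro: avoids_subseq)
  moreover have False if "b \<in> set u" "c \<in> set u" "b < x" "x < c" for b c
  proof -
    \<comment> \<open>The first alternative is an occurrence of 213, the second of 231.\<close>
    have "subseq [x, b, c] (x # u) \<or> subseq [x, c, b] (x # u)"
      using subseq_pair_total[of b u c] that by simp
    then show False using L that unfolding avoids_213_iff avoids_231_iff by blast
  qed
  ultimately show ?R by blast
next
  assume R: ?R
  have "\<not> (b < a \<and> a < c)" "\<not> (c < a \<and> a < b)" if abc: "subseq [a, b, c] (x # u)" for a b c
  proof -
    consider "subseq [a, b, c] u" | "a = x" "subseq [b, c] u"
      using abc by (cases "a = x") auto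
    then have "\<not> (b < a \<and> a < c) \<and> \<not> (c < a \<and> a < b)"
    proof cases
      case 1
      then show ?thesis using R unfolding avoids_213_iff avoids_231_iff by blast
    next
      case 2
      then have "b \<in> set u" "c \<in> set u" by (auto dest: set_subseq)
      then show ?thesis using R 2 by blast
    qed
    then show "\<not> (b < a \<and> a < c)" "\<not> (c < a \<and> a < b)" by auto
  qed
  then show ?L unfolding avoids_213_iff avoids_231_iff by blast
qed

text \<open>Neither 213 nor 312 begins with its smallest entry, so a leading minimum takes part in
  no occurrence.\<close>

lemma avoids_213_312_Cons_min:
  assumes "\<forall>y\<in>set u. m < y"
  shows "avoids (m # u) [2, 1, 3] \<and> avoids (m # u) [3, 1, 2] \<longleftrightarrow>
         avoids u [2, 1, 3] \<and> avoids u [3, 1, 2]"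
proof -
  have "subseq [a, b, c] u \<or> m < b \<and> a = m \<and> m < c" if "subseq [a, b, c] (m # u)" for a b c
    using that assms by (auto split: if_splits dest: set_subseq)
  then have "(b < a \<and> a < c \<or> b < c \<and> c < a) \<longrightarrow> subseq [a, b, c] u"
    if "subseq [a, b, c] (m # u)" for a b c
    using that by fastforce
  then have "avoids (m # u) [2, 1, 3] \<and> avoids (m # u) [3, 1, 2]"
    if "avoids u [2, 1, 3] \<and> avoids u [3, 1, 2]"
    using that unfolding avoids_213_iff avoids_312_iff by blast
  moreover have "subseq u (m # u)" by auto
  ultimately show ?thesis using avoids_subseq by blast
qed

text \<open>Neither pattern ends with its smallest entry, so a final minimum takes part in no
  occurrence.\<close>

lemma avoids_213_312_append_min:
  assumes "\<forall>y\<in>set u. m < y"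
  shows "avoids (u @ [m]) [2, 1, 3] \<and> avoids (u @ [m]) [3, 1, 2] \<longleftrightarrow>
         avoids u [2, 1, 3] \<and> avoids u [3, 1, 2]"
proof -
  have "subseq [a, b, c] u \<or> m < b \<and> m < a \<and> c = m" if abc: "subseq [a, b, c] (u @ [m])" for a b c
  proof -
    obtain p q where pq: "[a, b, c] = p @ q" "subseq p u" "subseq q [m]"
      using abc by (rule subseq_appendE)
    from pq(3) have "q = [] \<or> q = [m]" by (cases q) (auto split: if_splits)
    then show ?thesis
    proof
      assume "q = [m]"
      then have "p = [a, b]" "c = m" using pq(1) by (auto simp: append_eq_Cons_conv Cons_eq_append_conv)
      then show ?thesis using pq(2) assms by (auto dest: set_subseq)
    qed (use pq in simp)
  qed
  then have "(b < a \<and> a < c \<or> b < c \<and> c < a) \<longrightarrow> subseq [a, b, c] u"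
    if "subseq [a, b, c] (u @ [m])" for a b c
    using that by fastforce
  then have "avoids (u @ [m]) [2, 1, 3] \<and> avoids (u @ [m]) [3, 1, 2]"
    if "avoids u [2, 1, 3] \<and> avoids u [3, 1, 2]"
    using that unfolding avoids_213_iff avoids_312_iff by blast
  moreover have "subseq u (u @ [m])" by auto
  ultimately show ?thesis using avoids_subseq by blast
qed

text \<open>Letters \<open>a\<close> before and \<open>c\<close> after the minimum would form a
  valley: 213 if \<open>a < c\<close>, 312 if \<open>c < a\<close>.\<close>

lemma avoids_213_312_min_at_end:
  assumes "avoids (u @ m # v) [2, 1, 3]" "avoids (u @ m # v) [3, 1, 2]"
    and "distinct (u @ m # v)" "\<forall>y\<in>set u \<union> set v. m < y"
  shows "u = [] \<or> v = []"
proof (rule ccontr)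
  assume "\<not> ?thesis"
  then obtain a c where ac: "a \<in> set u" "c \<in> set v" by (meson last_in_set)
  then have "subseq ([a] @ [m, c]) (u @ m # v)"
    by (intro list_emb_append_mono) (auto simp: subseq_singleton_left)
  moreover have "m < a" "m < c" "a \<noteq> c" using ac assms(3,4) by auto
  ultimately show False using assms(1,2) unfolding avoids_213_iff avoids_312_iff
    by (metis append_Cons append_Nil linorder_neqE_nat)
qed

section \<open>The Jacobi property after adding a letter at an end\<close>

text \<open>\<open>rho\<close> looks only to the right of a letter, so a new first letter leaves the
  runs of the old letters unchanged.\<close>

lemma jacobi_Cons:
  assumes "x \<notin> set u"
  shows "jacobi (x # u) \<longleftrightarrow> even (length (takeWhile (\<lambda>y. x < y) u)) \<and> jacobi u"
proof -
  have "rho (x # u) y = rho u y" if "y \<in> set u" for y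
    using assms that by (auto simp: rho_def)
  then show ?thesis by (auto simp: jacobi_def) (auto simp: rho_def)
qed

text \<open>The run of a leading minimum is the whole remaining word; this is the only source of a
  parity condition in the count.\<close>

lemma jacobi_Cons_min:
  assumes "\<forall>y\<in>set u. m < y"
  shows "jacobi (m # u) \<longleftrightarrow> even (length u) \<and> jacobi u"
proof -
  have "m \<notin> set u" using assms by auto
  moreover have "takeWhile (\<lambda>y. m < y) u = u" 
    using assms unfolding takeWhile_eq_all_conv .
  ultimately show ?thesis by (simp only: jacobi_Cons not_False_eq_True)
qed

lemma jacobi_Cons_max:
  assumes "\<forall>y\<in>set u. y < m"
  shows "jacobi (m # u) \<longleftrightarrow> jacobi u"
proof -
  have "m \<notin> set u" "takeWhile (\<lambda>y. m < y) u = []"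
    using assms by (auto simp: takeWhile_eq_Nil_iff dest!: hd_in_set)
  then show ?thesis by (simp add: jacobi_Cons)
qed

text \<open>A final minimum has an empty run, and it stops every other run without being included in
  it.\<close>

lemma jacobi_append_min:
  assumes "\<forall>y\<in>set u. m < y"
  shows "jacobi (u @ [m]) \<longleftrightarrow> jacobi u"
proof -
  have "rho (u @ [m]) x = rho u x" if "x \<in> set u" for x
  proof -
    obtain p q where u: "u = p @ x # q" "x \<notin> set p" using split_list_first[of x u] \<open>x \<in> set u\<close> by blast
    have "m < x" using assms that by auto
    \<comment> \<open>Kept general in \<open>r\<close>, to serve for both \<open>q\<close> and
      \<open>q @ [m]\<close>.\<close>
    have d: "dropWhile (\<lambda>y. y \<noteq> x) (p @ x # r) = x # r" for r
      using u(2) by (subst dropWhile_append2) auto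
    have "takeWhile (\<lambda>y. x < y) (q @ [m]) = takeWhile (\<lambda>y. x < y) q"
      using \<open>m < x\<close> by (induction q) auto
    then show ?thesis by (simp add: rho_def u(1) d)
  qed
  moreover have "rho (u @ [m]) m = []"
  proof -
    have "dropWhile (\<lambda>y. y \<noteq> m) (u @ [m]) = [m]"
      using assms by (subst dropWhile_append2) auto
    then show ?thesis by (simp add: rho_def)
  qed
  ultimately show ?thesis by (auto simp: jacobi_def)
qed

section \<open>Recursive decomposition of the avoiders\<close>

text \<open>Arbitrary sets of letters replace \<open>{1..n}\<close> because removing a minimum
  leaves a set that is no longer an initial interval; no relabelling is then required.\<close>

definition jacobi_avoiders_on :: "nat set \<Rightarrow> nat list set \<Rightarrow> nat list set" where
  "jacobi_avoiders_on S P =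
     {\<pi> \<in> permutations_of_set S. jacobi \<pi> \<and> (\<forall>\<sigma> \<in> P. avoids \<pi> \<sigma>)}"

lemma finite_jacobi_avoiders_on: "finite (jacobi_avoiders_on S P)"
  by (simp add: jacobi_avoiders_on_def)

lemma jacobi_avoiders_on_singleton:
  "jacobi_avoiders_on {x} {[2, 1, 3], [2, 3, 1]} = {[x]}"
  "jacobi_avoiders_on {x} {[2, 1, 3], [3, 1, 2]} = {[x]}"
  by (auto simp: jacobi_avoiders_on_def jacobi_def rho_def
      avoids_213_iff[simplified] avoids_231_iff[simplified] avoids_312_iff[simplified]
      split: if_splits)

text \<open>By \<open>avoids_213_231_Cons\<close> the first letter is extreme. Removing a leading
  maximum is always reversible; restoring a leading minimum requires the other
  \<open>card S - 1\<close> letters to be even in number.\<close>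

lemma jacobi_avoiders_on_213_231:
  assumes S: "finite S" "card S \<ge> 2"
  shows "jacobi_avoiders_on S {[2, 1, 3], [2, 3, 1]} =
     (#) (Max S) ` jacobi_avoiders_on (S - {Max S}) {[2, 1, 3], [2, 3, 1]} \<union>
     (if odd (card S) then (#) (Min S) ` jacobi_avoiders_on (S - {Min S}) {[2, 1, 3], [2, 3, 1]} else {})"
    (is "?A S = ?B")
proof -
  have ne: "S \<noteq> {}" using S by auto
  have mem: "Max S \<in> S" "Min S \<in> S" using S ne by auto
  have lt_Max: "y < Max S" if "y \<in> S - {Max S}" for y using that S by (simp add: order.not_eq_order_implies_strict)
  have Min_lt: "Min S < y" if "y \<in> S - {Min S}" for y using that S by (simp add: order.not_eq_order_implies_strict)
  \<comment> \<open>If \<open>u\<close> is not a permutation of the reduced set, both sides fail, so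
    the equivalence holds for every \<open>u\<close>.\<close>
  have Amax: "Max S # u \<in> ?A S \<longleftrightarrow> u \<in> ?A (S - {Max S})" for u
  proof (cases "u \<in> permutations_of_set (S - {Max S})")
    case True
    then have "set u = S - {Max S}" by (rule permutations_of_setD)
    then have u: "\<forall>y\<in>set u. y < Max S" using lt_Max by auto
    then have "\<not> (\<exists>b\<in>set u. \<exists>c\<in>set u. b < Max S \<and> Max S < c)" by (meson less_asym)
    then have "avoids (Max S # u) [2, 1, 3] \<and> avoids (Max S # u) [2, 3, 1] \<longleftrightarrow>
        avoids u [2, 1, 3] \<and> avoids u [2, 3, 1]"
      unfolding avoids_213_231_Cons by blast
    with True mem jacobi_Cons_max[OF u] show ?thesis
      by (auto simp: jacobi_avoiders_on_def permutations_of_set_def)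
  next
    case False
    then show ?thesis by (auto simp: jacobi_avoiders_on_def permutations_of_set_def)
  qed
  have Amin: "Min S # u \<in> ?A S \<longleftrightarrow> odd (card S) \<and> u \<in> ?A (S - {Min S})" for u
  proof (cases "u \<in> permutations_of_set (S - {Min S})")
    case True
    then have u: "set u = S - {Min S}" "distinct u" by (auto dest: permutations_of_setD)
    then have "length u = card S - 1" using mem by (metis card_Diff_singleton distinct_card)
    \<comment> \<open>Since \<open>card S\<close> is positive, the truncated subtraction of one
      really flips the parity.\<close>
    then have "even (length u) \<longleftrightarrow> odd (card S)" using S by auto
    moreover have gt: "\<forall>y\<in>set u. Min S < y" using u Min_lt by auto
    then have "\<not> (\<exists>b\<in>set u. \<exists>c\<in>set u. b < Min S \<and> Min S < c)" by (meson less_asym)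
    then have "avoids (Min S # u) [2, 1, 3] \<and> avoids (Min S # u) [2, 3, 1] \<longleftrightarrow>
        avoids u [2, 1, 3] \<and> avoids u [2, 3, 1]"
      unfolding avoids_213_231_Cons by blast
    ultimately show ?thesis using True mem jacobi_Cons_min[OF gt]
      by (auto simp: jacobi_avoiders_on_def permutations_of_set_def)
  next
    case False
    then show ?thesis by (auto simp: jacobi_avoiders_on_def permutations_of_set_def)
  qed
  have ends: "\<exists>u. w = Max S # u \<or> w = Min S # u" if "w \<in> ?A S" for w
  proof -
    have w: "set w = S" using that by (auto simp: jacobi_avoiders_on_def dest: permutations_of_setD)
    with ne obtain x u where xu: "w = x # u" by (cases w) auto
    \<comment> \<open>Otherwise \<open>u\<close> contains both extremes, one below and one above
      \<open>x\<close>.\<close>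
    have "\<not> (Min S < x \<and> x < Max S)"
    proof
      assume "Min S < x \<and> x < Max S"
      moreover from this have "Min S \<in> set u" "Max S \<in> set u" using mem w xu by auto
      ultimately show False using that avoids_213_231_Cons[of x u]
        by (auto simp: jacobi_avoiders_on_def xu)
    qed
    moreover have "Min S \<le> x" "x \<le> Max S" using S w xu by auto
    ultimately show ?thesis using xu by auto
  qed
  show ?thesis
  proof (intro equalityI subsetI)
    fix w assume "w \<in> ?A S"
    then obtain u where "w = Max S # u \<and> u \<in> ?A (S - {Max S}) \<or>
        w = Min S # u \<and> odd (card S) \<and> u \<in> ?A (S - {Min S})"
      using ends[of w] Amax Amin by blast
    then show "w \<in> ?B" by (auto simp del: One_nat_def)
  next
    fix w assume "w \<in> ?B"
    then show "w \<in> ?A S" by (auto simp: Amax Amin simp del: One_nat_def split: if_splits)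
  qed
qed

text \<open>Here the minimum is removed in both cases: it stands last, with no parity condition, or
  first, with the other letters even in number.\<close>

lemma jacobi_avoiders_on_213_312:
  assumes S: "finite S" "card S \<ge> 2"
  shows "jacobi_avoiders_on S {[2, 1, 3], [3, 1, 2]} =
     (\<lambda>u. u @ [Min S]) ` jacobi_avoiders_on (S - {Min S}) {[2, 1, 3], [3, 1, 2]} \<union>
     (if odd (card S) then (#) (Min S) ` jacobi_avoiders_on (S - {Min S}) {[2, 1, 3], [3, 1, 2]} else {})"
    (is "?A S = ?B")
proof -
  have ne: "S \<noteq> {}" using S by auto
  have mem: "Min S \<in> S" using S ne by auto
  have Min_lt: "Min S < y" if "y \<in> S - {Min S}" for y using that S by (simp add: order.not_eq_order_implies_strict)
  have Alast: "u @ [Min S] \<in> ?A S \<longleftrightarrow> u \<in> ?A (S - {Min S})" for u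
  proof (cases "u \<in> permutations_of_set (S - {Min S})")
    case True
    then have "set u = S - {Min S}" by (rule permutations_of_setD)
    then have "\<forall>y\<in>set u. Min S < y" using Min_lt by auto
    with True mem show ?thesis
      using jacobi_append_min[of u "Min S"] avoids_213_312_append_min[of u "Min S"]
      by (auto simp: jacobi_avoiders_on_def permutations_of_set_def)
  next
    case False
    then show ?thesis by (auto simp: jacobi_avoiders_on_def permutations_of_set_def)
  qed
  have Afirst: "Min S # u \<in> ?A S \<longleftrightarrow> odd (card S) \<and> u \<in> ?A (S - {Min S})" for u
  proof (cases "u \<in> permutations_of_set (S - {Min S})")
    case True
    then have u: "set u = S - {Min S}" "distinct u" by (auto dest: permutations_of_setD)
    then have "length u = card S - 1" using mem by (metis card_Diff_singleton distinct_card)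
    then have "even (length u) \<longleftrightarrow> odd (card S)" using S by auto
    moreover have "\<forall>y\<in>set u. Min S < y" using u Min_lt by auto
    ultimately show ?thesis using True mem
      using jacobi_Cons_min[of u "Min S"] avoids_213_312_Cons_min[of u "Min S"]
      by (auto simp: jacobi_avoiders_on_def permutations_of_set_def)
  next
    case False
    then show ?thesis by (auto simp: jacobi_avoiders_on_def permutations_of_set_def)
  qed
  have ends: "\<exists>u. w = u @ [Min S] \<or> w = Min S # u" if "w \<in> ?A S" for w
  proof -
    have w: "set w = S" "distinct w" "avoids w [2, 1, 3]" "avoids w [3, 1, 2]"
      using that by (auto simp: jacobi_avoiders_on_def dest: permutations_of_setD)
    \<comment> \<open>Splitting at the minimum makes \<open>avoids_213_312_min_at_end\<close>
      applicable.\<close>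
    obtain u v where uv: "w = u @ Min S # v" using mem w(1) by (metis split_list)
    have "\<forall>y\<in>set u \<union> set v. Min S < y" using w(1,2) Min_lt by (auto simp: uv)
    then have "u = [] \<or> v = []" using w avoids_213_312_min_at_end[of u "Min S" v] uv by auto
    then show ?thesis using uv by auto
  qed
  show ?thesis
  proof (intro equalityI subsetI)
    fix w assume "w \<in> ?A S"
    then obtain u where "w = u @ [Min S] \<and> u \<in> ?A (S - {Min S}) \<or>
        w = Min S # u \<and> odd (card S) \<and> u \<in> ?A (S - {Min S})"
      using ends[of w] Alast Afirst by blast
    then show "w \<in> ?B" by (auto simp del: One_nat_def)
  next
    fix w assume "w \<in> ?B"
    then show "w \<in> ?A S" by (auto simp: Alast Afirst simp del: One_nat_def split: if_splits)
  qed
qed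

section \<open>Solving the recurrence and counting\<close>

text \<open>By induction the values at \<open>S - {x}\<close> and \<open>S - {y}\<close> depend only
  on the cardinality, so they agree and an odd size doubles the count. As \<open>x\<close> and
  \<open>y\<close> may differ or coincide, both decompositions are covered.\<close>

lemma doubling_at_odd_card:
  fixes N :: "'a set \<Rightarrow> nat"
  assumes "\<And>x. N {x} = 1"
    and "\<And>S. finite S \<Longrightarrow> card S \<ge> 2 \<Longrightarrow>
      \<exists>x\<in>S. \<exists>y\<in>S. N S = N (S - {x}) + (if odd (card S) then N (S - {y}) else 0)"
    and "finite S" "S \<noteq> {}"
  shows "N S = 2 ^ ((card S - 1) div 2)"
  using assms(3,4)
proof (induction "card S" arbitrary: S rule: less_induct)
  case less
  show ?case
  proof (cases "card S = 1")
    case True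
    then show ?thesis using assms(1) by (auto simp: card_1_singleton_iff)
  next
    case False
    moreover have "card S \<noteq> 0" using less.prems by simp
    ultimately have S: "card S \<ge> 2" by linarith
    then obtain x y where xy: "x \<in> S" "y \<in> S"
      and N: "N S = N (S - {x}) + (if odd (card S) then N (S - {y}) else 0)"
      using assms(2) less.prems by blast
    \<comment> \<open>One element is removed and the closed form subtracts another one, hence
      \<open>card S - 2\<close>.\<close>
    have IH: "N (S - {z}) = 2 ^ ((card S - 2) div 2)" if "z \<in> S" for z
    proof -
      have c: "card (S - {z}) = card S - 1" using that by simp
      have "S - {z} \<noteq> {}" using c S by fastforce
      then show ?thesis using less.hyps[of "S - {z}"] less.prems c S
        by (simp add: numeral_2_eq_2)
    qed
    show ?thesis
    proof (cases "odd (card S)")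
      case True
      then obtain k where k: "card S = 2 * k + 1" by (rule oddE)
      \<comment> \<open>The exponent in \<open>IH\<close> is \<open>(2 * k - 1) div 2 = l\<close>,
        and \<open>2 * 2 ^ l = 2 ^ k\<close>.\<close>
      with S obtain l where "k = Suc l" by (cases k) auto
      with k show ?thesis using N IH xy by simp
    next
      case False
      then obtain k where k: "card S = 2 * k" by auto
      \<comment> \<open>Both \<open>(2 * k - 2) div 2\<close> and \<open>(2 * k - 1) div 2\<close>
        equal \<open>l\<close>, so the value is unchanged.\<close>
      with S obtain l where "k = Suc l" by (cases k) auto
      with k show ?thesis using N IH xy by simp
    qed
  qed
qed

lemma card_Un_images_if:
  assumes "finite A" "finite B" "inj_on f A" "inj_on g B" "f ` A \<inter> g ` B = {}"
  shows "card (f ` A \<union> (if P then g ` B else {})) = card A + (if P then card B else 0)"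
  using assms by (simp add: card_Un_disjoint card_image)

lemma card_jacobi_avoiders_on:
  assumes "finite S" "S \<noteq> {}"
  shows "card (jacobi_avoiders_on S {[2, 1, 3], [2, 3, 1]}) = 2 ^ ((card S - 1) div 2)"
    and "card (jacobi_avoiders_on S {[2, 1, 3], [3, 1, 2]}) = 2 ^ ((card S - 1) div 2)"
proof -
  show "card (jacobi_avoiders_on S {[2, 1, 3], [2, 3, 1]}) = 2 ^ ((card S - 1) div 2)"
  proof (rule doubling_at_odd_card[OF _ _ assms])
    fix S :: "nat set" assume S: "finite S" "card S \<ge> 2"
    then have mem: "Max S \<in> S" "Min S \<in> S" by (auto intro!: Max_in Min_in)
    \<comment> \<open>Words in the two images then differ in their first letter.\<close>
    have "Min S \<noteq> Max S"
    proof
      assume "Min S = Max S"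
      then have "S \<subseteq> {Min S}" using S(1) by (metis Max_ge Min_le antisym singletonI subsetI)
      then show False using S card_mono[of "{Min S}" S] by auto
    qed
    then have disj: "(#) (Max S) ` A \<inter> (#) (Min S) ` B = {}" for A B by auto
    \<comment> \<open>The witnesses are \<open>x = Max S\<close> and
      \<open>y = Min S\<close>.\<close>
    show "\<exists>x\<in>S. \<exists>y\<in>S. card (jacobi_avoiders_on S {[2, 1, 3], [2, 3, 1]}) =
      card (jacobi_avoiders_on (S - {x}) {[2, 1, 3], [2, 3, 1]}) +
      (if odd (card S) then card (jacobi_avoiders_on (S - {y}) {[2, 1, 3], [2, 3, 1]}) else 0)"
      unfolding jacobi_avoiders_on_213_231[OF S]
      by (intro bexI[OF bexI[OF _ mem(2)] mem(1)] card_Un_images_if finite_jacobi_avoiders_on disj) auto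
  qed (simp only: jacobi_avoiders_on_singleton, simp)
  show "card (jacobi_avoiders_on S {[2, 1, 3], [3, 1, 2]}) = 2 ^ ((card S - 1) div 2)"
  proof (rule doubling_at_odd_card[OF _ _ assms])
    fix S :: "nat set" assume S: "finite S" "card S \<ge> 2"
    let ?A = "jacobi_avoiders_on (S - {Min S}) {[2, 1, 3], [3, 1, 2]}"
    from S have mem: "Min S \<in> S" by (auto intro!: Min_in)
    \<comment> \<open>As \<open>S\<close> has a second element, \<open>u\<close> is nonempty, and
      its first letter is not \<open>Min S\<close>.\<close>
    have "u @ [Min S] \<noteq> Min S # v" if "u \<in> ?A" for u v
    proof -
      have u: "set u = S - {Min S}"
        using that by (auto simp: jacobi_avoiders_on_def dest: permutations_of_setD)
      have "card (S - {Min S}) \<noteq> 0" using S mem by simp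
      then have "u \<noteq> []" using u by (metis card.empty list.set(1))
      moreover have "Min S \<notin> set u" unfolding u by blast
      ultimately show ?thesis by (cases u) simp_all
    qed
    then have disj: "(\<lambda>u. u @ [Min S]) ` ?A \<inter> (#) (Min S) ` ?A = {}" by blast
    \<comment> \<open>Both witnesses are \<open>Min S\<close>.\<close>
    show "\<exists>x\<in>S. \<exists>y\<in>S. card (jacobi_avoiders_on S {[2, 1, 3], [3, 1, 2]}) =
      card (jacobi_avoiders_on (S - {x}) {[2, 1, 3], [3, 1, 2]}) +
      (if odd (card S) then card (jacobi_avoiders_on (S - {y}) {[2, 1, 3], [3, 1, 2]}) else 0)"
      unfolding jacobi_avoiders_on_213_312[OF S]
      by (intro bexI[OF bexI[OF _ mem] mem] card_Un_images_if finite_jacobi_avoiders_on disj)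
        (auto simp: inj_on_def)
  qed (simp only: jacobi_avoiders_on_singleton, simp)
qed

theorem theorem8p6:
  fixes n :: nat and \<sigma> :: "nat list"
  assumes "n \<ge> 1" and "\<sigma> \<in> {[2, 3, 1], [3, 1, 2]}"
  shows "j_num n {[2, 1, 3], \<sigma>} = 2 ^ ((n - 1) div 2)"
proof -
  have "jacobi_avoiders n P = jacobi_avoiders_on {1..n} P" for P
    by (simp add: jacobi_avoiders_def jacobi_avoiders_on_def)
  then show ?thesis
    using assms card_jacobi_avoiders_on[of "{1..n}"] by (auto simp: j_num_def)
qed

end
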